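(* (I) Let $U$ be a set and $\mathcal{Y}\subseteq\mathcal{P}(U)$ the family of base sets. For each $X\in\mathcal{Y}$ let $\mathcal{F}(X)\subseteq\mathcal{P}(X)$ be a system of big subsets satisfying $(FAll)$ and $(F\uparrow)$, with dual system $\mathcal{I}(X)=\{X-A:A\in\mathcal{F}(X)\}$ of small subsets, and suppose that for every $X\in\mathcal{Y}$ there is a smallest (with respect to inclusion) element $f(X)$ of $\mathcal{F}(X)$. Then, for $f:\mathcal{Y}\to\mathcal{P}(U)$ so defined: (1.1) $(R\uparrow)\Rightarrow(\mu wOR)$; (2.1) $(R\uparrow)$ and $(I\cup)$ $\Rightarrow(\mu OR)$; (3.1) $(R\uparrow)$ and $(I\cup)$ $\Rightarrow(\mu PR)$; (4.1) $(R\cup disj)\Rightarrow(\mu disjOR)$; (5.1) $(R\downarrow)\Rightarrow(\mu CM)$; (6.1) $(R\downarrow\downarrow)\Rightarrow(\mu RatM)$. In (5.1) and (6.1), $\mathcal{Y}$ is assumed to be closed under set difference. (II) Conversely, let $\mathcal{Y}=\mathcal{P}(U)$, let $f:\mathcal{P}(U)\to\mathcal{P}(U)$ with $f(X)\subseteq X$ for all $X$, and define $\mathcal{F}(X):=\{X':f(X)\subseteq X'\subseteq X\}$, $\mathcal{I}(X):=\{X-A:A\in\mathcal{F}(X)\}$. Then: (1.2) $(\mu wOR)\Rightarrow(R\uparrow)$; (2.2) $(\mu OR)\Rightarrow(R\uparrow)$ and $(I\cup)$; (3.2) $(\mu PR)\Rightarrow(R\uparrow)$ and $(I\cup)$; (4.2)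 $(\mu disjOR)\Rightarrow(R\cup disj)$; (5.2) $(\mu CM)\Rightarrow(R\downarrow)$; (6.2) $(\mu RatM)\Rightarrow(R\downarrow\downarrow)$.
   Context: Conditions on $\mathcal{F}$ and $\mathcal{I}$ (base sets $X,Y$ range over $\mathcal{Y}$, and a condition is required whenever the base sets occurring in it belong to $\mathcal{Y}$; $A,B$ are subsets of the relevant base sets): $(FAll)$: $X\in\mathcal{F}(X)$. $(F\uparrow)$: $A\subseteq B\subseteq X$, $A\in\mathcal{F}(X)\Rightarrow B\in\mathcal{F}(X)$. $(I\cup)$: $A,B\in\mathcal{I}(X)\Rightarrow A\cup B\in\mathcal{I}(X)$. $(R\uparrow)$: $X\subseteq Y\Rightarrow\mathcal{I}(X)\subseteq\mathcal{I}(Y)$. $(R\cup disj)$: $A\in\mathcal{I}(X)$, $B\in\mathcal{I}(Y)$, $X\cap Y=\emptyset\Rightarrow A\cup B\in\mathcal{I}(X\cup Y)$. $(R\downarrow)$: $A,B\in\mathcal{I}(X)\Rightarrow A-B\in\mathcal{I}(X-B)$. $(R\downarrow\downarrow)$: $A\in\mathcal{I}(X)$, $B\subseteq X$, $B\notin\mathcal{F}(X)\Rightarrow A-B\in\mathcal{I}(X-B)$. Conditions on $f$ (for $X,Y\in\mathcal{Y}$, whenever all sets to which $f$ is applied are in $\mathcal{Y}$): $(\mu wOR)$: $f(X\cup Y)\subseteq f(X)\cup Y$. $(\mu OR)$: $f(X\cup Y)\subseteq f(X)\cup f(Y)$. $(\mu PR)$: $X\subseteq Y\Rightarrow f(Y)\cap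 X\subseteq f(X)$. $(\mu disjOR)$: $X\cap Y=\emptyset\Rightarrow f(X\cup Y)\subseteq f(X)\cup f(Y)$. $(\mu CM)$: $f(X)\subseteq Y\subseteq X\Rightarrow f(Y)\subseteq f(X)$. $(\mu RatM)$: $X\subseteq Y$, $X\cap f(Y)\neq\emptyset\Rightarrow f(X)\subseteq f(Y)\cap X$. *)

theory Defs
  imports Main
begin

text \<open>
  Throughout, \<open>\<Y>\<close> is the family of base sets, and \<open>F\<close>, \<open>I\<close>, \<open>f\<close> are total HOL functions of which
  only the values at members of \<open>\<Y>\<close> matter: every condition below is relativised to \<open>\<Y>\<close>, including
  membership of compound base sets such as \<open>X \<union> Y\<close> or \<open>X - B\<close>.
\<close>

definition small_sets :: "('a set \<Rightarrow> 'a set set) \<Rightarrow> 'a set \<Rightarrow> 'a set set" where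
  "small_sets F X = {X - A | A. A \<in> F X}"

definition smallest_element :: "'a set set \<Rightarrow> 'a set \<Rightarrow> bool" where
  "smallest_element S M \<longleftrightarrow> M \<in> S \<and> (\<forall>A\<in>S. M \<subseteq> A)"

definition generated_big_sets :: "('a set \<Rightarrow> 'a set) \<Rightarrow> 'a set \<Rightarrow> 'a set set" where
  "generated_big_sets f X = {X'. f X \<subseteq> X' \<and> X' \<subseteq> X}"

definition closed_under_diff :: "'a set set \<Rightarrow> bool" where
  "closed_under_diff \<Y> \<longleftrightarrow> (\<forall>X\<in>\<Y>. \<forall>Y\<in>\<Y>. X - Y \<in> \<Y>)"


definition F_All :: "'a set set \<Rightarrow> ('a set \<Rightarrow> 'a set set) \<Rightarrow> bool" where
  "F_All \<Y> F \<longleftrightarrow> (\<forall>X\<in>\<Y>. X \<in> F X)"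

definition F_up :: "'a set set \<Rightarrow> ('a set \<Rightarrow> 'a set set) \<Rightarrow> bool" where
  "F_up \<Y> F \<longleftrightarrow> (\<forall>X\<in>\<Y>. \<forall>A B. A \<subseteq> B \<and> B \<subseteq> X \<and> A \<in> F X \<longrightarrow> B \<in> F X)"

definition I_Un :: "'a set set \<Rightarrow> ('a set \<Rightarrow> 'a set set) \<Rightarrow> bool" where
  "I_Un \<Y> I \<longleftrightarrow> (\<forall>X\<in>\<Y>. \<forall>A B. A \<in> I X \<and> B \<in> I X \<longrightarrow> A \<union> B \<in> I X)"

definition R_up :: "'a set set \<Rightarrow> ('a set \<Rightarrow> 'a set set) \<Rightarrow> bool" where
  "R_up \<Y> I \<longleftrightarrow> (\<forall>X\<in>\<Y>. \<forall>Y\<in>\<Y>. X \<subseteq> Y \<longrightarrow> I X \<subseteq> I Y)"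

definition R_Un_disj :: "'a set set \<Rightarrow> ('a set \<Rightarrow> 'a set set) \<Rightarrow> bool" where
  "R_Un_disj \<Y> I \<longleftrightarrow> (\<forall>X\<in>\<Y>. \<forall>Y\<in>\<Y>. X \<union> Y \<in> \<Y> \<longrightarrow>
     (\<forall>A B. A \<in> I X \<and> B \<in> I Y \<and> X \<inter> Y = {} \<longrightarrow> A \<union> B \<in> I (X \<union> Y)))"

definition R_down :: "'a set set \<Rightarrow> ('a set \<Rightarrow> 'a set set) \<Rightarrow> bool" where
  "R_down \<Y> I \<longleftrightarrow> (\<forall>X\<in>\<Y>. \<forall>A B. X - B \<in> \<Y> \<longrightarrow>
     A \<in> I X \<and> B \<in> I X \<longrightarrow> A - B \<in> I (X - B))"

definition R_down_down ::
  "'a set set \<Rightarrow> ('a set \<Rightarrow> 'a set set) \<Rightarrow> ('a set \<Rightarrow> 'a set set) \<Rightarrow> bool" where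
  "R_down_down \<Y> F I \<longleftrightarrow> (\<forall>X\<in>\<Y>. \<forall>A B. X - B \<in> \<Y> \<longrightarrow>
     A \<in> I X \<and> B \<subseteq> X \<and> B \<notin> F X \<longrightarrow> A - B \<in> I (X - B))"


definition mu_wOR :: "'a set set \<Rightarrow> ('a set \<Rightarrow> 'a set) \<Rightarrow> bool" where
  "mu_wOR \<Y> f \<longleftrightarrow> (\<forall>X\<in>\<Y>. \<forall>Y\<in>\<Y>. X \<union> Y \<in> \<Y> \<longrightarrow> f (X \<union> Y) \<subseteq> f X \<union> Y)"

definition mu_OR :: "'a set set \<Rightarrow> ('a set \<Rightarrow> 'a set) \<Rightarrow> bool" where
  "mu_OR \<Y> f \<longleftrightarrow> (\<forall>X\<in>\<Y>. \<forall>Y\<in>\<Y>. X \<union> Y \<in> \<Y> \<longrightarrow> f (X \<union> Y) \<subseteq> f X \<union> f Y)"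

definition mu_PR :: "'a set set \<Rightarrow> ('a set \<Rightarrow> 'a set) \<Rightarrow> bool" where
  "mu_PR \<Y> f \<longleftrightarrow> (\<forall>X\<in>\<Y>. \<forall>Y\<in>\<Y>. X \<subseteq> Y \<longrightarrow> f Y \<inter> X \<subseteq> f X)"

definition mu_disjOR :: "'a set set \<Rightarrow> ('a set \<Rightarrow> 'a set) \<Rightarrow> bool" where
  "mu_disjOR \<Y> f \<longleftrightarrow> (\<forall>X\<in>\<Y>. \<forall>Y\<in>\<Y>. X \<union> Y \<in> \<Y> \<longrightarrow>
     X \<inter> Y = {} \<longrightarrow> f (X \<union> Y) \<subseteq> f X \<union> f Y)"

definition mu_CM :: "'a set set \<Rightarrow> ('a set \<Rightarrow> 'a set) \<Rightarrow> bool" where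
  "mu_CM \<Y> f \<longleftrightarrow> (\<forall>X\<in>\<Y>. \<forall>Y\<in>\<Y>. f X \<subseteq> Y \<and> Y \<subseteq> X \<longrightarrow> f Y \<subseteq> f X)"

definition mu_RatM :: "'a set set \<Rightarrow> ('a set \<Rightarrow> 'a set) \<Rightarrow> bool" where
  "mu_RatM \<Y> f \<longleftrightarrow> (\<forall>X\<in>\<Y>. \<forall>Y\<in>\<Y>. X \<subseteq> Y \<and> X \<inter> f Y \<noteq> {} \<longrightarrow> f X \<subseteq> f Y \<inter> X)"

end

theory Submission imports Defs begin

text \<open>
  When every system of big sets has a least element, it is the principal filter over that element:
  \<open>A\<close> is big in \<open>X\<close> iff \<open>f X \<subseteq> A \<subseteq> X\<close>, and \<open>A\<close> is small in \<open>X\<close> iff \<open>A \<subseteq> X\<close> misses \<open>f X\<close>. Both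
  halves of the theorem describe this one situation, which is the locale below.

  Moreover \<open>X - f X\<close> is the largest small subset of \<open>X\<close>. A condition stating that small sets stay
  small when the base set changes is therefore decided by these largest ones, for which it becomes
  an inclusion between values of \<open>f\<close>. In this way
  (R-up) is equivalent to (mu-PR), the disjoint union rule to (mu-disjOR), (R-down) to (mu-CM) and
  the rule for subsets that are not big to (mu-RatM); these equivalences hold for any family of base
  sets. Small sets are automatically closed under union, so what remains is to compare the
  three rules (mu-PR), (mu-OR) and (mu-wOR). They weaken in this order; if the base sets are
  closed under difference, the last one gives back the first, because \<open>Y = X \<union> (Y - X)\<close> for \<open>X \<subseteq> Y\<close>.
\<close>

locale principal_big_sets =
  fixes \<Y> :: "'a set set" and F I :: "'a set \<Rightarrow> 'a set set" and f :: "'a set \<Rightarrow> 'a set"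
  assumes f_subset: "X \<in> \<Y> \<Longrightarrow> f X \<subseteq> X"
    and big: "X \<in> \<Y> \<Longrightarrow> F X = generated_big_sets f X"
    and small: "X \<in> \<Y> \<Longrightarrow> I X = small_sets F X"
begin

lemma big_iff: "X \<in> \<Y> \<Longrightarrow> A \<in> F X \<longleftrightarrow> f X \<subseteq> A \<and> A \<subseteq> X"
  by (simp add: big generated_big_sets_def)

lemma small_iff:
  assumes "X \<in> \<Y>"
  shows "A \<in> I X \<longleftrightarrow> A \<subseteq> X \<and> A \<inter> f X = {}"
proof
  assume "A \<in> I X"
  then obtain B where "B \<in> F X" "A = X - B"
    using assms by (auto simp: small small_sets_def)
  then show "A \<subseteq> X \<and> A \<inter> f X = {}"
    using assms by (auto simp: big_iff)
next
  assume A: "A \<subseteq> X \<and> A \<inter> f X = {}"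
  then have "X - A \<in> F X" "A = X - (X - A)"
    using assms f_subset by (auto simp: big_iff)
  then show "A \<in> I X"
    using assms unfolding small[OF assms] small_sets_def by blast
qed

lemma largest_small: "X \<in> \<Y> \<Longrightarrow> X - f X \<in> I X"
  by (auto simp: small_iff)

lemma I_Un: "I_Un \<Y> I"
  unfolding I_Un_def by (auto simp: small_iff)

text \<open>
  All small subsets of \<open>X\<close> are small in \<open>Y \<supseteq> X\<close> iff the largest one, \<open>X - f X\<close>, misses \<open>f Y\<close>,
  and that is (mu-PR) for \<open>X\<close> and \<open>Y\<close>.
\<close>

lemma R_up_iff_mu_PR: "R_up \<Y> I \<longleftrightarrow> mu_PR \<Y> f"
proof
  assume R: "R_up \<Y> I"
  show "mu_PR \<Y> f"
    unfolding mu_PR_def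
  proof (intro ballI impI)
    fix X Y assume XY: "X \<in> \<Y>" "Y \<in> \<Y>" "X \<subseteq> Y"
    then have "X - f X \<in> I Y"
      using R largest_small unfolding R_up_def by blast
    then show "f Y \<inter> X \<subseteq> f X"
      using XY by (auto simp: small_iff)
  qed
next
  assume PR: "mu_PR \<Y> f"
  show "R_up \<Y> I"
    unfolding R_up_def
  proof (intro ballI impI subsetI)
    fix X Y A assume XY: "X \<in> \<Y>" "Y \<in> \<Y>" "X \<subseteq> Y" and A: "A \<in> I X"
    then have "f Y \<inter> X \<subseteq> f X"
      using PR unfolding mu_PR_def by blast
    then show "A \<in> I Y"
      using XY A by (auto simp: small_iff)
  qed
qed

lemma mu_PR_imp_mu_OR:
  assumes "mu_PR \<Y> f"
  shows "mu_OR \<Y> f"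
  unfolding mu_OR_def
proof (intro ballI impI)
  fix X Y assume XY: "X \<in> \<Y>" "Y \<in> \<Y>" "X \<union> Y \<in> \<Y>"
  then have "f (X \<union> Y) \<inter> X \<subseteq> f X" "f (X \<union> Y) \<inter> Y \<subseteq> f Y"
    using assms unfolding mu_PR_def by auto
  then show "f (X \<union> Y) \<subseteq> f X \<union> f Y"
    using f_subset[OF XY(3)] by blast
qed

lemma mu_OR_imp_mu_wOR:
  assumes "mu_OR \<Y> f"
  shows "mu_wOR \<Y> f"
  unfolding mu_wOR_def
proof (intro ballI impI)
  fix X Y assume XY: "X \<in> \<Y>" "Y \<in> \<Y>" "X \<union> Y \<in> \<Y>"
  then have "f (X \<union> Y) \<subseteq> f X \<union> f Y"
    using assms unfolding mu_OR_def by simp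
  then show "f (X \<union> Y) \<subseteq> f X \<union> Y"
    using f_subset[OF XY(2)] by blast
qed

lemma mu_wOR_imp_mu_PR:
  assumes "closed_under_diff \<Y>" and "mu_wOR \<Y> f"
  shows "mu_PR \<Y> f"
  unfolding mu_PR_def
proof (intro ballI impI)
  fix X Y assume XY: "X \<in> \<Y>" "Y \<in> \<Y>" "X \<subseteq> Y"
  have Y: "X \<union> (Y - X) = Y"
    using XY(3) by blast
  have diff: "Y - X \<in> \<Y>"
    using assms(1) XY unfolding closed_under_diff_def by simp
  have "f (X \<union> (Y - X)) \<subseteq> f X \<union> (Y - X)"
    using assms(2)[unfolded mu_wOR_def, rule_format, of X "Y - X"] XY diff
      by (simp only: Y simp_thms)
  then have "f Y \<subseteq> f X \<union> (Y - X)"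
    unfolding Y .
  then show "f Y \<inter> X \<subseteq> f X"
    by blast
qed

text \<open>
  Disjointness of \<open>X\<close> and \<open>Y\<close> keeps \<open>A \<subseteq> X\<close> away from \<open>f Y\<close> and \<open>B \<subseteq> Y\<close> away from \<open>f X\<close>, so
  that \<open>A \<union> B\<close> misses all of \<open>f X \<union> f Y\<close>.
\<close>

lemma R_Un_disj_iff_mu_disjOR: "R_Un_disj \<Y> I \<longleftrightarrow> mu_disjOR \<Y> f"
proof
  assume R: "R_Un_disj \<Y> I"
  show "mu_disjOR \<Y> f"
    unfolding mu_disjOR_def
  proof (intro ballI impI)
    fix X Y assume XY: "X \<in> \<Y>" "Y \<in> \<Y>" "X \<union> Y \<in> \<Y>" "X \<inter> Y = {}"
    then have "(X - f X) \<union> (Y - f Y) \<in> I (X \<union> Y)"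
      using R largest_small unfolding R_Un_disj_def by simp
    then show "f (X \<union> Y) \<subseteq> f X \<union> f Y"
      using XY f_subset[OF XY(3)] by (auto simp: small_iff)
  qed
next
  assume OR: "mu_disjOR \<Y> f"
  show "R_Un_disj \<Y> I"
    unfolding R_Un_disj_def
  proof (intro ballI allI impI, elim conjE)
    fix X Y A B
    assume XY: "X \<in> \<Y>" "Y \<in> \<Y>" "X \<union> Y \<in> \<Y>" "X \<inter> Y = {}" and AB: "A \<in> I X" "B \<in> I Y"
    then have f_Un: "f (X \<union> Y) \<subseteq> f X \<union> f Y"
      using OR unfolding mu_disjOR_def by blast
    have "A \<subseteq> X" "A \<inter> f X = {}" "B \<subseteq> Y" "B \<inter> f Y = {}"
      using XY AB by (auto simp: small_iff)
    then have "A \<union> B \<subseteq> X \<union> Y" "(A \<union> B) \<inter> f (X \<union> Y) = {}"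
      using f_Un XY(4) f_subset[OF XY(1)] f_subset[OF XY(2)] by blast+
    then show "A \<union> B \<in> I (X \<union> Y)"
      using XY(3) by (simp add: small_iff)
  qed
qed

text \<open>
  The sets \<open>X - B\<close> with \<open>B\<close> small in \<open>X\<close> are exactly the \<open>Y\<close> with \<open>f X \<subseteq> Y \<subseteq> X\<close> to which
  (mu-CM) refers.
\<close>

lemma R_down_iff_mu_CM: "R_down \<Y> I \<longleftrightarrow> mu_CM \<Y> f"
proof
  assume R: "R_down \<Y> I"
  show "mu_CM \<Y> f"
    unfolding mu_CM_def
  proof (intro ballI impI, elim conjE)
    fix X Y assume XY: "X \<in> \<Y>" "Y \<in> \<Y>" "f X \<subseteq> Y" "Y \<subseteq> X"
    have Y: "X - (X - Y) = Y"
      using XY(4) by blast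
    have "X - Y \<in> I X"
      using XY by (auto simp: small_iff)
    then have "(X - f X) - (X - Y) \<in> I (X - (X - Y))"
      using R[unfolded R_down_def, rule_format, of X "X - Y" "X - f X"] XY largest_small
      by (simp only: Y simp_thms)
    then show "f Y \<subseteq> f X"
      using XY f_subset[OF XY(2)] unfolding Y small_iff[OF XY(2)] by blast
  qed
next
  assume CM: "mu_CM \<Y> f"
  show "R_down \<Y> I"
    unfolding R_down_def
  proof (intro ballI allI impI, elim conjE)
    fix X A B assume X: "X \<in> \<Y>" "X - B \<in> \<Y>" and AB: "A \<in> I X" "B \<in> I X"
    then have "f X \<subseteq> X - B"
      using f_subset by (auto simp: small_iff)
    then have "f (X - B) \<subseteq> f X"
      using CM X unfolding mu_CM_def by blast
    then show "A - B \<in> I (X - B)"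
      using X AB by (auto simp: small_iff)
  qed
qed

text \<open>
  A subset \<open>B\<close> of \<open>X\<close> fails to be big in \<open>X\<close> iff \<open>X - B\<close> meets \<open>f X\<close>, which is the hypothesis
  of (mu-RatM) for the pair \<open>X - B \<subseteq> X\<close>.
\<close>

lemma R_down_down_iff_mu_RatM: "R_down_down \<Y> F I \<longleftrightarrow> mu_RatM \<Y> f"
proof
  assume R: "R_down_down \<Y> F I"
  show "mu_RatM \<Y> f"
    unfolding mu_RatM_def
  proof (intro ballI impI, elim conjE)
    fix X Y assume XY: "X \<in> \<Y>" "Y \<in> \<Y>" "X \<subseteq> Y" "X \<inter> f Y \<noteq> {}"
    have X: "Y - (Y - X) = X"
      using XY(3) by blast
    have "Y - X \<notin> F Y"
      using XY by (auto simp: big_iff)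
    then have "(Y - f Y) - (Y - X) \<in> I (Y - (Y - X))"
      using R[unfolded R_down_down_def, rule_format, of Y "Y - X" "Y - f Y"] XY largest_small
      by (simp only: X Diff_subset simp_thms)
    then show "f X \<subseteq> f Y \<inter> X"
      using XY f_subset[OF XY(1)] unfolding X small_iff[OF XY(1)] by blast
  qed
next
  assume RatM: "mu_RatM \<Y> f"
  show "R_down_down \<Y> F I"
    unfolding R_down_down_def
  proof (intro ballI allI impI, elim conjE)
    fix X A B
    assume X: "X \<in> \<Y>" "X - B \<in> \<Y>" and A: "A \<in> I X" and B: "B \<subseteq> X" "B \<notin> F X"
    then have "(X - B) \<inter> f X \<noteq> {}"
      using f_subset by (auto simp: big_iff)
    then have "f (X - B) \<subseteq> f X \<inter> (X - B)"
      using RatM X unfolding mu_RatM_def by blast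
    then show "A - B \<in> I (X - B)"
      using X A by (auto simp: small_iff)
  qed
qed

end

lemma smallest_element_generates_big_sets:
  assumes "F X \<subseteq> Pow X" and "smallest_element (F X) (f X)"
    and "\<And>A B. A \<subseteq> B \<Longrightarrow> B \<subseteq> X \<Longrightarrow> A \<in> F X \<Longrightarrow> B \<in> F X"
  shows "F X = generated_big_sets f X"
proof
  show "F X \<subseteq> generated_big_sets f X"
    using assms(1,2) unfolding smallest_element_def generated_big_sets_def by auto
  have "f X \<in> F X"
    using assms(2) unfolding smallest_element_def by simp
  then show "generated_big_sets f X \<subseteq> F X"
    unfolding generated_big_sets_def by (auto intro: assms(3))
qed

lemma principal_big_sets_of_smallest:
  assumes "\<And>X. X \<in> \<Y> \<Longrightarrow> F X \<subseteq> Pow X" and "F_up \<Y> F"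
    and "\<And>X. X \<in> \<Y> \<Longrightarrow> I X = small_sets F X"
    and "\<And>X. X \<in> \<Y> \<Longrightarrow> smallest_element (F X) (f X)"
  shows "principal_big_sets \<Y> F I f"
proof
  fix X assume X: "X \<in> \<Y>"
  show "f X \<subseteq> X"
    using assms(1)[OF X] assms(4)[OF X] unfolding smallest_element_def by blast
  show "F X = generated_big_sets f X"
    using assms(1)[OF X] assms(4)[OF X]
  proof (rule smallest_element_generates_big_sets)
    show "B \<in> F X" if "A \<subseteq> B" "B \<subseteq> X" "A \<in> F X" for A B
      using assms(2) X that unfolding F_up_def by blast
  qed
  show "I X = small_sets F X"
    using assms(3)[OF X] .
qed

theorem fact6p3:
  shows
  "(\<forall>(U :: 'a set) (\<Y> :: 'a set set) (F :: 'a set \<Rightarrow> 'a set set)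
      (I :: 'a set \<Rightarrow> 'a set set) (f :: 'a set \<Rightarrow> 'a set).
      \<Y> \<subseteq> Pow U \<and>
      (\<forall>X\<in>\<Y>. F X \<subseteq> Pow X) \<and>
      F_All \<Y> F \<and> F_up \<Y> F \<and>
      (\<forall>X\<in>\<Y>. I X = small_sets F X) \<and>
      (\<forall>X\<in>\<Y>. smallest_element (F X) (f X)) \<longrightarrow>
        (R_up \<Y> I \<longrightarrow> mu_wOR \<Y> f) \<and>
        (R_up \<Y> I \<and> I_Un \<Y> I \<longrightarrow> mu_OR \<Y> f) \<and>
        (R_up \<Y> I \<and> I_Un \<Y> I \<longrightarrow> mu_PR \<Y> f) \<and>
        (R_Un_disj \<Y> I \<longrightarrow> mu_disjOR \<Y> f) \<and>
        (closed_under_diff \<Y> \<longrightarrow> R_down \<Y> I \<longrightarrow> mu_CM \<Y> f) \<and>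
        (closed_under_diff \<Y> \<longrightarrow> R_down_down \<Y> F I \<longrightarrow> mu_RatM \<Y> f))
   \<and>
   (\<forall>(U :: 'a set) (\<Y> :: 'a set set) (F :: 'a set \<Rightarrow> 'a set set)
      (I :: 'a set \<Rightarrow> 'a set set) (f :: 'a set \<Rightarrow> 'a set).
      \<Y> = Pow U \<and>
      (\<forall>X\<in>\<Y>. f X \<subseteq> X) \<and>
      (\<forall>X\<in>\<Y>. F X = generated_big_sets f X) \<and>
      (\<forall>X\<in>\<Y>. I X = small_sets F X) \<longrightarrow>
        (mu_wOR \<Y> f \<longrightarrow> R_up \<Y> I) \<and>
        (mu_OR \<Y> f \<longrightarrow> R_up \<Y> I \<and> I_Un \<Y> I) \<and>
        (mu_PR \<Y> f \<longrightarrow> R_up \<Y> I \<and> I_Un \<Y> I) \<and>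
        (mu_disjOR \<Y> f \<longrightarrow> R_Un_disj \<Y> I) \<and>
        (mu_CM \<Y> f \<longrightarrow> R_down \<Y> I) \<and>
        (mu_RatM \<Y> f \<longrightarrow> R_down_down \<Y> F I))"
proof (rule conjI; intro allI impI; elim conjE)
  fix U :: "'a set" and \<Y> :: "'a set set" and F I f
  assume "\<forall>X\<in>\<Y>. F X \<subseteq> Pow X" "F_up \<Y> F" "\<forall>X\<in>\<Y>. I X = small_sets F X"
    "\<forall>X\<in>\<Y>. smallest_element (F X) (f X)"
  then interpret principal_big_sets \<Y> F I f
    by (intro principal_big_sets_of_smallest) simp_all
  show "(R_up \<Y> I \<longrightarrow> mu_wOR \<Y> f) \<and>
        (R_up \<Y> I \<and> I_Un \<Y> I \<longrightarrow> mu_OR \<Y> f) \<and>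
        (R_up \<Y> I \<and> I_Un \<Y> I \<longrightarrow> mu_PR \<Y> f) \<and>
        (R_Un_disj \<Y> I \<longrightarrow> mu_disjOR \<Y> f) \<and>
        (closed_under_diff \<Y> \<longrightarrow> R_down \<Y> I \<longrightarrow> mu_CM \<Y> f) \<and>
        (closed_under_diff \<Y> \<longrightarrow> R_down_down \<Y> F I \<longrightarrow> mu_RatM \<Y> f)"
    using R_up_iff_mu_PR mu_PR_imp_mu_OR mu_OR_imp_mu_wOR R_Un_disj_iff_mu_disjOR
      R_down_iff_mu_CM R_down_down_iff_mu_RatM by metis
next
  fix U :: "'a set" and \<Y> :: "'a set set" and F I f
  assume \<Y>: "\<Y> = Pow U" and "\<forall>X\<in>\<Y>. f X \<subseteq> X" "\<forall>X\<in>\<Y>. F X = generated_big_sets f X"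
    "\<forall>X\<in>\<Y>. I X = small_sets F X"
  then interpret principal_big_sets \<Y> F I f
    by unfold_locales simp_all
  have "closed_under_diff \<Y>"
    unfolding \<Y> closed_under_diff_def by blast
  then show "(mu_wOR \<Y> f \<longrightarrow> R_up \<Y> I) \<and>
        (mu_OR \<Y> f \<longrightarrow> R_up \<Y> I \<and> I_Un \<Y> I) \<and>
        (mu_PR \<Y> f \<longrightarrow> R_up \<Y> I \<and> I_Un \<Y> I) \<and>
        (mu_disjOR \<Y> f \<longrightarrow> R_Un_disj \<Y> I) \<and>
        (mu_CM \<Y> f \<longrightarrow> R_down \<Y> I) \<and>
        (mu_RatM \<Y> f \<longrightarrow> R_down_down \<Y> F I)"
    using R_up_iff_mu_PR I_Un mu_wOR_imp_mu_PR mu_OR_imp_mu_wOR R_Un_disj_iff_mu_disjOR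
      R_down_iff_mu_CM R_down_down_iff_mu_RatM by metis
qed

end
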